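(* Let $E$ be a Banach space of density $\aleph_1$ with a skeleton $\{E_\alpha\}_{\alpha<\omega_1}$ such that $E_\alpha$ is $1$-complemented in $E_{\alpha+1}$ for every $\alpha<\omega_1$. Then $E$ is a $1$-Plichko space.
   Context: A skeleton $\{E_\alpha\}_{\alpha<\omega_1}$ indexed by $\omega_1$ in a Banach space $E$ of density $\aleph_1$ is a sequence of closed separable subspaces with $E_\alpha\subseteq E_\beta$ for $\alpha<\beta<\omega_1$, $E=\bigcup_{\alpha<\omega_1}E_\alpha$, and $E_\delta=\operatorname{cl}(\bigcup_{\alpha<\delta}E_\alpha)$ for every limit ordinal $\delta<\omega_1$. A subspace $F$ of a Banach space $G$ is $1$-complemented in $G$ if there is a linear projection $P\colon G\to G$ with $F=PG$ and $\|P\|\leqslant1$. A projectional resolution of the identity (PRI) in a Banach space $E$ of density $\aleph_1$ is a sequence $\{P_\alpha\}_{\alpha<\omega_1}$ of linear projections of $E$ onto separable subspaces such that (1) $\|P_\alpha\|=1$; (2) $\alpha\leqslant\beta$ implies $P_\alpha=P_\alpha P_\beta=P_\beta P_\alpha$; (3) $E=\bigcup_{\alpha<\omega_1}P_\alpha E$ and $P_\delta E=\operatorname{cl}(\bigcup_{\xi<\delta}P_\xi E)$ for every limit ordinal $\delta<\omega_1$. A Banach space of density $\aleph_1$ is $1$-Plichko if it has a PRI. *)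

theory Defs
  imports "HOL-Analysis.Analysis" "HOL-Library.Equipollence"
begin

text \<open>The ordinals below \<open>\<omega>\<^sub>1\<close>: the elements of the cardinal successor of \<open>natLeq\<close>, in its
  (initial) well-order. The lemmas below pin this type down as \<open>\<omega>\<^sub>1\<close>.\<close>

typedef omega1 = "Field (cardSuc natLeq)"
  using Field_cardSuc_not_empty[OF natLeq_Card_order] by blast

setup_lifting type_definition_omega1

lemma Well_order_cardSuc_natLeq: "Well_order (cardSuc natLeq)"
  using cardSuc_Card_order[OF natLeq_Card_order] card_order_on_well_order_on by blast

instantiation omega1 :: linorder
begin

lift_definition less_eq_omega1 :: "omega1 \<Rightarrow> omega1 \<Rightarrow> bool"
  is "\<lambda>a b. (a, b) \<in> cardSuc natLeq" .

definition less_omega1 :: "omega1 \<Rightarrow> omega1 \<Rightarrow> bool"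
  where "less_omega1 a b \<longleftrightarrow> a \<le> b \<and> \<not> b \<le> a"

instance
proof -
  have lo: "Linear_order (cardSuc natLeq)"
    using Well_order_cardSuc_natLeq by (simp add: well_order_on_def)
  then have r: "Refl (cardSuc natLeq)" and t: "trans (cardSuc natLeq)"
    and a: "antisym (cardSuc natLeq)" and tot: "Total (cardSuc natLeq)"
    by (auto simp: linear_order_on_def partial_order_on_def preorder_on_def)
  show "OFCLASS(omega1, linorder_class)"
  proof
    fix x y z :: omega1
    show "x < y \<longleftrightarrow> x \<le> y \<and> \<not> y \<le> x" by (rule less_omega1_def)
    show "x \<le> x" using r by transfer (auto simp: refl_on_def)
    show "x \<le> y \<Longrightarrow> y \<le> z \<Longrightarrow> x \<le> z" using t by transfer (meson transD)
    show "x \<le> y \<Longrightarrow> y \<le> x \<Longrightarrow> x = y" using a by transfer (meson antisymD)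
    show "x \<le> y \<or> y \<le> x"
      using tot r by transfer (metis refl_on_def total_on_def)
  qed
qed

end

instance omega1 :: wellorder
proof
  fix P :: "omega1 \<Rightarrow> bool" and a :: omega1
  assume step: "\<And>x. (\<And>y. y < x \<Longrightarrow> P y) \<Longrightarrow> P x"
  have "wf (cardSuc natLeq - Id)"
    using Well_order_cardSuc_natLeq by (simp add: well_order_on_def)
  then have "wf (inv_image (cardSuc natLeq - Id) Rep_omega1)"
    by (rule wf_inv_image)
  moreover have "{(x, y). x < y} \<subseteq> inv_image (cardSuc natLeq - Id) Rep_omega1"
    by (auto simp: less_omega1_def less_eq_omega1.rep_eq Rep_omega1_inject)
  ultimately have "wf {(x::omega1, y). x < y}"
    by (rule wf_subset)
  then show "P a"
    by (induct rule: wf_induct_rule) (use step in auto)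
qed

lemma card_of_UNIV_omega1:
  includes cardinal_syntax
  shows "|UNIV :: omega1 set| =o cardSuc natLeq"
proof -
  have "bij_betw Rep_omega1 UNIV (Field (cardSuc natLeq))"
    by (metis Rep_omega1_inject inj_on_imp_bij_betw injI type_definition.Rep_range
        type_definition_omega1)
  then have "|UNIV :: omega1 set| =o |Field (cardSuc natLeq)|"
    using card_of_ordIso by blast
  then show ?thesis
    using card_of_Field_ordIso[OF cardSuc_Card_order[OF natLeq_Card_order]] ordIso_transitive
    by blast
qed

lemma uncountable_UNIV_omega1:
  includes cardinal_syntax
  shows "uncountable (UNIV :: omega1 set)"
proof
  assume "countable (UNIV :: omega1 set)"
  then have "|UNIV :: omega1 set| \<le>o |UNIV :: nat set|"
    by (auto simp: countable_def card_of_ordLeq[symmetric])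
  then have "cardSuc natLeq \<le>o natLeq"
    using card_of_UNIV_omega1 card_of_nat ordIso_symmetric ordIso_ordLeq_trans
      ordLeq_ordIso_trans by metis
  then show False
    using cardSuc_greater[OF natLeq_Card_order] not_ordLess_ordLeq by blast
qed

lemma countable_lessThan_omega1:
  includes cardinal_syntax
  shows "countable {..<a :: omega1}"
proof -
  have "|underS (cardSuc natLeq) (Rep_omega1 a)| <o cardSuc natLeq"
    using card_of_underS[OF cardSuc_Card_order[OF natLeq_Card_order] Rep_omega1] .
  then have "|underS (cardSuc natLeq) (Rep_omega1 a)| \<le>o natLeq"
    using cardSuc_ordLeq_ordLess[OF natLeq_Card_order card_of_Card_order] by blast
  then have "|underS (cardSuc natLeq) (Rep_omega1 a)| \<le>o |UNIV :: nat set|"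
    using card_of_nat ordIso_symmetric ordLeq_ordIso_trans by blast
  then have "countable (underS (cardSuc natLeq) (Rep_omega1 a))"
    by (auto simp: countable_def card_of_ordLeq[symmetric])
  moreover have "Rep_omega1 ` {..<a} \<subseteq> underS (cardSuc natLeq) (Rep_omega1 a)"
    by (auto simp: underS_def less_omega1_def less_eq_omega1.rep_eq Rep_omega1_inject)
  ultimately show ?thesis
    by (meson Rep_omega1_inject countable_image_inj_on countable_subset inj_onI)
qed

definition succ_omega1 :: "omega1 \<Rightarrow> omega1"
  where "succ_omega1 \<alpha> = (LEAST \<beta>. \<alpha> < \<beta>)"

lemma less_succ_omega1: "\<alpha> < succ_omega1 \<alpha>"
proof -
  have "\<exists>\<beta>. \<alpha> < \<beta>"
  proof (rule ccontr)
    assume "\<not> ?thesis"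
    then have "UNIV = insert \<alpha> {..<\<alpha>}"
      by (auto simp: not_less le_less)
    then show False
      using uncountable_UNIV_omega1 countable_lessThan_omega1 countable_insert by metis
  qed
  then show ?thesis
    unfolding succ_omega1_def by (rule LeastI_ex)
qed

lemma succ_omega1_le_iff: "succ_omega1 \<alpha> \<le> \<beta> \<longleftrightarrow> \<alpha> < \<beta>"
  using less_succ_omega1 unfolding succ_omega1_def by (meson Least_le order.strict_trans2)

text \<open>Zero is not counted as a limit ordinal.\<close>

definition limit_omega1 :: "omega1 \<Rightarrow> bool"
  where "limit_omega1 \<delta> \<longleftrightarrow> (\<exists>\<alpha>. \<alpha> < \<delta>) \<and> (\<forall>\<alpha><\<delta>. succ_omega1 \<alpha> < \<delta>)"

text \<open>Density \<open>\<aleph>\<^sub>1\<close>: the least cardinality of a dense subset is that of \<open>\<omega>\<^sub>1\<close>.\<close>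

definition density_aleph1 :: "'a::topological_space itself \<Rightarrow> bool"
  where "density_aleph1 _ \<longleftrightarrow>
    (\<exists>D :: 'a set. closure D = UNIV \<and> D \<approx> (UNIV :: omega1 set)) \<and>
    (\<forall>D :: 'a set. closure D = UNIV \<longrightarrow> (UNIV :: omega1 set) \<lesssim> D)"

definition skeleton :: "(omega1 \<Rightarrow> 'a::banach set) \<Rightarrow> bool"
  where "skeleton E \<longleftrightarrow>
    (\<forall>\<alpha>. subspace (E \<alpha>) \<and> closed (E \<alpha>) \<and> separable_space (top_of_set (E \<alpha>))) \<and>
    (\<forall>\<alpha> \<beta>. \<alpha> < \<beta> \<longrightarrow> E \<alpha> \<subseteq> E \<beta>) \<and>
    (\<Union>\<alpha>. E \<alpha>) = UNIV \<and>
    (\<forall>\<delta>. limit_omega1 \<delta> \<longrightarrow> E \<delta> = closure (\<Union>\<alpha>\<in>{..<\<delta>}. E \<alpha>))"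

text \<open>A projection of the subspace \<open>G\<close> is a function on the ambient type of which only the
  restriction to \<open>G\<close> matters; linearity and the norm bound are therefore relativised to \<open>G\<close>.\<close>

definition one_complemented :: "'a::real_normed_vector set \<Rightarrow> 'a set \<Rightarrow> bool"
  where "one_complemented F G \<longleftrightarrow>
    (\<exists>P. P \<in> G \<rightarrow> G \<and>
      (\<forall>x\<in>G. \<forall>y\<in>G. P (x + y) = P x + P y) \<and>
      (\<forall>c. \<forall>x\<in>G. P (c *\<^sub>R x) = c *\<^sub>R P x) \<and>
      (\<forall>x\<in>G. P (P x) = P x) \<and>
      P ` G = F \<and>
      (\<forall>x\<in>G. norm (P x) \<le> norm x))"

text \<open>Idempotence of the \<open>P \<alpha>\<close> is the case \<open>\<alpha> = \<beta>\<close> of the commutation condition.\<close>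

definition projectional_resolution :: "(omega1 \<Rightarrow> 'a::banach \<Rightarrow> 'a) \<Rightarrow> bool"
  where "projectional_resolution P \<longleftrightarrow>
    (\<forall>\<alpha>. bounded_linear (P \<alpha>) \<and> separable_space (top_of_set (range (P \<alpha>)))) \<and>
    (\<forall>\<alpha>. onorm (P \<alpha>) = 1) \<and>
    (\<forall>\<alpha> \<beta>. \<alpha> \<le> \<beta> \<longrightarrow> P \<alpha> = P \<alpha> \<circ> P \<beta> \<and> P \<alpha> = P \<beta> \<circ> P \<alpha>) \<and>
    (\<Union>\<alpha>. range (P \<alpha>)) = UNIV \<and>
    (\<forall>\<delta>. limit_omega1 \<delta> \<longrightarrow> range (P \<delta>) = closure (\<Union>\<xi>\<in>{..<\<delta>}. range (P \<xi>)))"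

definition one_Plichko :: "'a::banach itself \<Rightarrow> bool"
  where "one_Plichko T \<longleftrightarrow>
    density_aleph1 T \<and> (\<exists>P :: omega1 \<Rightarrow> 'a \<Rightarrow> 'a. projectional_resolution P)"

end

theory Submission
  imports Defs
begin

text \<open>
  Projections \<open>R \<gamma> : E (\<gamma> + 1) \<rightarrow> E \<gamma>\<close> are given only between neighbouring members of the
  skeleton. They are composed transfinitely to contractive projections \<open>Q \<alpha>\<close> of the whole
  space onto \<open>E \<alpha>\<close>. A vector \<open>x\<close> enters the skeleton at a definite ordinal, its rank. If this
  rank is at most \<open>\<alpha>\<close>, then \<open>Q \<alpha> x = x\<close>. If it is a successor \<open>\<gamma> + 1\<close> above \<open>\<alpha>\<close>, then
  \<open>Q \<alpha> x = Q \<alpha> (R \<gamma> x)\<close>. If it is a limit ordinal above \<open>\<alpha>\<close>, then \<open>x\<close> is a limit of vectors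
  of smaller rank, and \<open>Q \<alpha> x\<close> is the limit of their images. In both of the last cases the value
  at \<open>x\<close> is the limit of the values along one sequence of vectors of smaller rank (a constant
  sequence at successors), so a single well-founded recursion on the rank defines \<open>Q \<alpha>\<close>.

  Induction on \<open>\<beta>\<close> shows that \<open>Q \<alpha>\<close> is a linear contraction of \<open>E \<beta>\<close> into \<open>E \<alpha>\<close>
  (\<open>descend_on_skeleton\<close>). At limits the point is that \<open>Q \<alpha>\<close> is 1-Lipschitz on the union
  of the earlier subspaces, so that it extends to the closure by completeness, and the choice of
  the approximating sequence does not matter (\<open>descend_tendsto_at_limit\<close>). A second induction on
  the rank gives \<open>Q \<alpha> \<circ> Q \<beta> = Q \<alpha>\<close> for \<open>\<alpha> \<le> \<beta>\<close> (\<open>descend_descend\<close>).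

  These projections have norm 1 unless \<open>E \<alpha> = {0}\<close>, which may happen at the beginning of
  the skeleton. Therefore the resolution is \<open>\<alpha> \<mapsto> Q (max \<alpha>\<^sub>0 \<alpha>)\<close>, where \<open>E \<alpha>\<^sub>0 \<noteq> {0}\<close>:
  delaying the start keeps the commutation rules and the continuity at limit ordinals.
\<close>

section \<open>Linear contractions on subspaces\<close>

definition linear_contraction_on :: "'a::real_normed_vector set \<Rightarrow> ('a \<Rightarrow> 'b::real_normed_vector) \<Rightarrow> bool"
  where "linear_contraction_on S f \<longleftrightarrow>
    (\<forall>x\<in>S. \<forall>y\<in>S. f (x + y) = f x + f y) \<and>
    (\<forall>c. \<forall>x\<in>S. f (c *\<^sub>R x) = c *\<^sub>R f x) \<and>
    (\<forall>x\<in>S. norm (f x) \<le> norm x)"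

lemma linear_contraction_on_lipschitz:
  assumes "linear_contraction_on S f" "subspace S"
  shows "1-lipschitz_on S f"
proof (rule lipschitz_onI)
  fix x y assume xy: "x \<in> S" "y \<in> S"
  have "f (x + (-1) *\<^sub>R y) = f x + (-1) *\<^sub>R f y"
    using assms xy unfolding linear_contraction_on_def by (metis subspace_scale)
  moreover have "norm (f (x + (-1) *\<^sub>R y)) \<le> norm (x + (-1) *\<^sub>R y)"
    using assms xy unfolding linear_contraction_on_def
    by (metis subspace_scale subspace_add)
  ultimately show "dist (f x) (f y) \<le> 1 * dist x y"
    by (simp add: dist_norm)
qed simp

lemma linear_contraction_on_closure:
  assumes lc: "linear_contraction_on U f" and U: "subspace U"
    and cont: "\<And>x t. x \<in> closure U \<Longrightarrow> (\<And>n. t n \<in> U) \<Longrightarrow> t \<longlonglongrightarrow> x \<Longrightarrow> (\<lambda>n. f (t n)) \<longlonglongrightarrow> f x"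
  shows "linear_contraction_on (closure U) f"
  unfolding linear_contraction_on_def
proof (intro conjI ballI allI)
  fix x y assume x: "x \<in> closure U" and y: "y \<in> closure U"
  obtain s where s: "\<And>n. s n \<in> U" "s \<longlonglongrightarrow> x" using x closure_sequential by metis
  obtain t where t: "\<And>n. t n \<in> U" "t \<longlonglongrightarrow> y" using y closure_sequential by metis
  have st: "s n + t n \<in> U" "(\<lambda>n. s n + t n) \<longlonglongrightarrow> x + y" for n
    by (intro subspace_add[OF U] tendsto_add s t)+
  then have "x + y \<in> closure U"
    unfolding closure_sequential by (intro exI[of _ "\<lambda>n. s n + t n"]) simp
  then have "(\<lambda>n. f (s n + t n)) \<longlonglongrightarrow> f (x + y)"
    by (rule cont) (rule st)+
  moreover have "(\<lambda>n. f (s n + t n)) = (\<lambda>n. f (s n) + f (t n))"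
    using lc s t unfolding linear_contraction_on_def by auto
  moreover have "(\<lambda>n. f (s n) + f (t n)) \<longlonglongrightarrow> f x + f y"
    by (intro tendsto_add cont x y s t)
  ultimately show "f (x + y) = f x + f y"
    by (metis LIMSEQ_unique)
next
  fix c x assume x: "x \<in> closure U"
  obtain s where s: "\<And>n. s n \<in> U" "s \<longlonglongrightarrow> x" using x closure_sequential by metis
  have cs: "c *\<^sub>R s n \<in> U" "(\<lambda>n. c *\<^sub>R s n) \<longlonglongrightarrow> c *\<^sub>R x" for n
    by (intro subspace_scale[OF U] tendsto_scaleR tendsto_const s)+
  then have "c *\<^sub>R x \<in> closure U"
    unfolding closure_sequential by (intro exI[of _ "\<lambda>n. c *\<^sub>R s n"]) simp
  then have "(\<lambda>n. f (c *\<^sub>R s n)) \<longlonglongrightarrow> f (c *\<^sub>R x)"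
    by (rule cont) (rule cs)+
  moreover have "(\<lambda>n. f (c *\<^sub>R s n)) = (\<lambda>n. c *\<^sub>R f (s n))"
    using lc s unfolding linear_contraction_on_def by auto
  moreover have "(\<lambda>n. c *\<^sub>R f (s n)) \<longlonglongrightarrow> c *\<^sub>R f x"
    by (intro tendsto_scaleR tendsto_const cont x s)
  ultimately show "f (c *\<^sub>R x) = c *\<^sub>R f x"
    by (metis LIMSEQ_unique)
next
  fix x assume x: "x \<in> closure U"
  obtain s where s: "\<And>n. s n \<in> U" "s \<longlonglongrightarrow> x" using x closure_sequential by metis
  show "norm (f x) \<le> norm x"
  proof (rule LIMSEQ_le)
    show "(\<lambda>n. norm (f (s n))) \<longlonglongrightarrow> norm (f x)" by (intro tendsto_norm cont x s)
    show "(\<lambda>n. norm (s n)) \<longlonglongrightarrow> norm x" by (intro tendsto_norm s)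
    show "\<exists>N. \<forall>n\<ge>N. norm (f (s n)) \<le> norm (s n)"
      using lc s unfolding linear_contraction_on_def by auto
  qed
qed

lemma subspace_UN_chain:
  fixes E :: "'i::linorder \<Rightarrow> 'a::real_vector set"
  assumes sub: "\<And>i. subspace (E i)" and mono: "mono E" and "I \<noteq> {}"
  shows "subspace (\<Union>i\<in>I. E i)"
  unfolding subspace_def
proof (intro conjI ballI allI)
  show "0 \<in> (\<Union>i\<in>I. E i)" using assms by (auto intro: subspace_0)
next
  fix x y assume "x \<in> (\<Union>i\<in>I. E i)" "y \<in> (\<Union>i\<in>I. E i)"
  then obtain i j where ij: "i \<in> I" "x \<in> E i" "j \<in> I" "y \<in> E j" by auto
  then have "x \<in> E (max i j)" "y \<in> E (max i j)"
    using mono by (meson max.cobounded1 max.cobounded2 monoD subsetD)+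
  then have "x + y \<in> E (max i j)" using sub by (simp add: subspace_add)
  moreover have "max i j \<in> I" using ij by (simp add: max_def)
  ultimately show "x + y \<in> (\<Union>i\<in>I. E i)" by blast
next
  fix c x assume "x \<in> (\<Union>i\<in>I. E i)"
  then show "c *\<^sub>R x \<in> (\<Union>i\<in>I. E i)" using sub by (auto intro: subspace_scale)
qed

lemma linear_contraction_on_UN_chain:
  fixes E :: "'i::linorder \<Rightarrow> 'a::real_normed_vector set"
  assumes mono: "mono E" and lc: "\<And>i. i \<in> I \<Longrightarrow> linear_contraction_on (E i) f"
  shows "linear_contraction_on (\<Union>i\<in>I. E i) f"
  unfolding linear_contraction_on_def
proof (intro conjI ballI allI)
  fix x y assume "x \<in> (\<Union>i\<in>I. E i)" "y \<in> (\<Union>i\<in>I. E i)"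
  then obtain i j where ij: "i \<in> I" "x \<in> E i" "j \<in> I" "y \<in> E j" by auto
  then have "x \<in> E (max i j)" "y \<in> E (max i j)"
    using mono by (meson max.cobounded1 max.cobounded2 monoD subsetD)+
  moreover have "max i j \<in> I" using ij by (simp add: max_def)
  ultimately show "f (x + y) = f x + f y"
    using lc unfolding linear_contraction_on_def by blast
qed (use lc in \<open>auto simp: linear_contraction_on_def\<close>)

lemma onorm_contractive_projection:
  assumes P: "bounded_linear P" and contr: "\<And>x. norm (P x) \<le> norm x"
    and fixed: "P v = v" "v \<noteq> 0"
  shows "onorm P = 1"
proof (rule antisym)
  show "onorm P \<le> 1" by (rule onorm_bound) (simp_all add: contr)
  have "norm v \<le> onorm P * norm v" using onorm[OF P, of v] fixed by simp
  then show "1 \<le> onorm P" using fixed by simp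
qed

section \<open>Countable ordinals and skeletons\<close>

lemma less_succ_omega1_iff: "\<beta> < succ_omega1 \<alpha> \<longleftrightarrow> \<beta> \<le> \<alpha>"
  by (meson linorder_not_le succ_omega1_le_iff)

lemma omega1_successor_or_limit:
  assumes "\<alpha> < \<beta>"
  obtains \<gamma> where "\<alpha> \<le> \<gamma>" "\<beta> = succ_omega1 \<gamma>" | "limit_omega1 \<beta>"
proof (cases "limit_omega1 \<beta>")
  case False
  then obtain \<gamma> where \<gamma>: "\<gamma> < \<beta>" "\<beta> \<le> succ_omega1 \<gamma>"
    using assms unfolding limit_omega1_def by (meson linorder_not_le)
  then have "\<beta> = succ_omega1 \<gamma>" by (simp add: antisym succ_omega1_le_iff)
  with assms show ?thesis using that(1) less_succ_omega1_iff by blast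
qed (use that in blast)

lemma not_limit_succ_omega1: "\<not> limit_omega1 (succ_omega1 \<gamma>)"
  unfolding limit_omega1_def using less_succ_omega1 by blast

lemma skeleton_mono: "skeleton E \<Longrightarrow> mono E"
  unfolding skeleton_def by (metis monoI order.order_iff_strict subset_refl)

lemma density_aleph1_imp_nonzero:
  assumes "density_aleph1 TYPE('a::real_normed_vector)"
  shows "\<exists>v::'a. v \<noteq> 0"
proof (rule ccontr)
  assume "\<not> ?thesis"
  then have "closure {0::'a} = UNIV" by auto
  then have "(UNIV :: omega1 set) \<lesssim> {0::'a}"
    using assms unfolding density_aleph1_def by blast
  then show False
    using uncountable_UNIV_omega1 by (meson countable_empty countable_insert countable_lepoll)
qed

lemma one_complemented_retraction:
  assumes "one_complemented F G" "F \<subseteq> G"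
  obtains P where "linear_contraction_on G P" "\<And>x. x \<in> G \<Longrightarrow> P x \<in> F" "\<And>x. x \<in> F \<Longrightarrow> P x = x"
proof -
  obtain P where P: "\<forall>x\<in>G. \<forall>y\<in>G. P (x + y) = P x + P y"
      "\<forall>c. \<forall>x\<in>G. P (c *\<^sub>R x) = c *\<^sub>R P x" "\<forall>x\<in>G. P (P x) = P x" "P ` G = F"
      "\<forall>x\<in>G. norm (P x) \<le> norm x"
    using assms(1) unfolding one_complemented_def by blast
  have "P x = x" if "x \<in> F" for x using that P(3,4) by auto
  then show ?thesis using that[of P] P unfolding linear_contraction_on_def by auto
qed

section \<open>Transfinite composition of the neighbouring projections\<close>

locale complemented_skeleton =
  fixes E :: "omega1 \<Rightarrow> 'a::banach set" and R :: "omega1 \<Rightarrow> 'a \<Rightarrow> 'a"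
  assumes skeleton: "skeleton E"
    and R_contraction: "linear_contraction_on (E (succ_omega1 \<gamma>)) (R \<gamma>)"
    and R_in: "x \<in> E (succ_omega1 \<gamma>) \<Longrightarrow> R \<gamma> x \<in> E \<gamma>"
    and R_fixes: "x \<in> E \<gamma> \<Longrightarrow> R \<gamma> x = x"
begin

lemma subspace_E: "subspace (E \<alpha>)"
  and closed_E: "closed (E \<alpha>)"
  and separable_E: "separable_space (top_of_set (E \<alpha>))"
  and UN_E: "(\<Union>\<alpha>. E \<alpha>) = UNIV"
  and E_limit: "limit_omega1 \<delta> \<Longrightarrow> E \<delta> = closure (\<Union>\<alpha>\<in>{..<\<delta>}. E \<alpha>)"
  using skeleton unfolding skeleton_def by auto

lemmas mono_E = skeleton_mono[OF skeleton]

definition rank :: "'a \<Rightarrow> omega1" where "rank x = (LEAST \<beta>. x \<in> E \<beta>)"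

lemma rank_le_iff: "rank x \<le> \<beta> \<longleftrightarrow> x \<in> E \<beta>"
proof
  have "x \<in> E (rank x)" unfolding rank_def by (rule LeastI_ex) (use UN_E in blast)
  then show "rank x \<le> \<beta> \<Longrightarrow> x \<in> E \<beta>" using mono_E by (meson monoD subsetD)
qed (simp add: rank_def Least_le)

lemma in_E_rank: "x \<in> E (rank x)"
  using rank_le_iff by blast

lemma UN_below_iff: "x \<in> (\<Union>\<beta>\<in>{..<\<delta>}. E \<beta>) \<longleftrightarrow> rank x < \<delta>"
  by (auto simp: rank_le_iff[symmetric] intro: in_E_rank)

text \<open>
  The vectors of smaller rank from which the recursion computes its value at \<open>x\<close>. Taking a
  constant sequence at successor ranks lets one recursion equation serve both kinds of rank.
\<close>

definition lower_seq :: "'a \<Rightarrow> nat \<Rightarrow> 'a" where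
  "lower_seq x = (if \<exists>\<gamma>. rank x = succ_omega1 \<gamma> then (\<lambda>_. R (THE \<gamma>. rank x = succ_omega1 \<gamma>) x)
    else (SOME s. (\<forall>n. rank (s n) < rank x) \<and> s \<longlonglongrightarrow> x))"

lemma lower_seq_succ:
  assumes "rank x = succ_omega1 \<gamma>"
  shows "lower_seq x n = R \<gamma> x"
proof -
  have "(THE \<gamma>. rank x = succ_omega1 \<gamma>) = \<gamma>"
    using assms by (intro the_equality) (auto, metis antisym less_succ_omega1 less_succ_omega1_iff)
  then show ?thesis using assms unfolding lower_seq_def by auto
qed

lemma lower_seq_limit:
  assumes "limit_omega1 (rank x)"
  shows "rank (lower_seq x n) < rank x" "lower_seq x \<longlonglongrightarrow> x"
proof -
  have "x \<in> closure (\<Union>\<beta>\<in>{..<rank x}. E \<beta>)"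
    using E_limit[OF assms] in_E_rank by blast
  then obtain s where "\<forall>n. s n \<in> (\<Union>\<beta>\<in>{..<rank x}. E \<beta>)" "s \<longlonglongrightarrow> x"
    unfolding closure_sequential by blast
  then have "\<exists>s. (\<forall>n. rank (s n) < rank x) \<and> s \<longlonglongrightarrow> x"
    unfolding UN_below_iff by blast
  moreover have "lower_seq x = (SOME s. (\<forall>n. rank (s n) < rank x) \<and> s \<longlonglongrightarrow> x)"
    using assms not_limit_succ_omega1 unfolding lower_seq_def by metis
  ultimately have "(\<forall>n. rank (lower_seq x n) < rank x) \<and> lower_seq x \<longlonglongrightarrow> x"
    using someI_ex[of "\<lambda>s. (\<forall>n. rank (s n) < rank x) \<and> s \<longlonglongrightarrow> x"] by simp
  then show "rank (lower_seq x n) < rank x" "lower_seq x \<longlonglongrightarrow> x" by auto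
qed

lemma rank_lower_seq:
  assumes "\<alpha> < rank x"
  shows "rank (lower_seq x n) < rank x"
  using assms
proof (cases rule: omega1_successor_or_limit)
  case (1 \<gamma>)
  then have "R \<gamma> x \<in> E \<gamma>" using R_in in_E_rank by metis
  then have "rank (R \<gamma> x) < rank x"
    using 1 rank_le_iff less_succ_omega1_iff by metis
  then show ?thesis using 1 lower_seq_succ by simp
next
  case 2
  then show ?thesis by (rule lower_seq_limit)
qed

text \<open>
  The projection called \<open>Q \<alpha>\<close> in the introduction. The test on the rank always succeeds where
  it is evaluated; it is there to make the recursion visibly well-founded.
\<close>

function descend :: "omega1 \<Rightarrow> 'a \<Rightarrow> 'a" where
  "descend \<alpha> x = (if rank x \<le> \<alpha> then x
    else lim (\<lambda>n. if rank (lower_seq x n) < rank x then descend \<alpha> (lower_seq x n) else 0))"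
  by pat_completeness auto
termination
  by (relation "inv_image {(a, b). a < b} (\<lambda>(\<alpha>, x). rank x)") (auto intro: wf)

declare descend.simps [simp del]

lemma descend_id: "x \<in> E \<alpha> \<Longrightarrow> descend \<alpha> x = x"
  by (simp add: descend.simps rank_le_iff)

lemma descend_lim: "\<alpha> < rank x \<Longrightarrow> descend \<alpha> x = lim (\<lambda>n. descend \<alpha> (lower_seq x n))"
  by (subst descend.simps) (auto simp: rank_lower_seq)

lemma descend_succ:
  assumes "\<alpha> \<le> \<gamma>" "x \<in> E (succ_omega1 \<gamma>)"
  shows "descend \<alpha> x = descend \<alpha> (R \<gamma> x)"
proof (cases "x \<in> E \<gamma>")
  case False
  then have "rank x = succ_omega1 \<gamma>"
    using assms(2) by (metis antisym linorder_not_le rank_le_iff succ_omega1_le_iff)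
  then show ?thesis
    using assms(1) by (simp add: descend_lim less_succ_omega1_iff lower_seq_succ)
qed (simp add: R_fixes)

text \<open>
  Completeness enters here: if \<open>x\<close> has rank \<open>\<delta>\<close>, the images along the sequence used in the
  recursion are Cauchy, hence converge to the value at \<open>x\<close>; if \<open>x\<close> has smaller rank, the
  constant sequence \<open>x\<close> does the same. By the Lipschitz bound, the images along any other
  sequence with limit \<open>x\<close> are at distance tending to 0 from these.
\<close>

lemma descend_tendsto_at_limit:
  assumes \<delta>: "limit_omega1 \<delta>" "\<alpha> < \<delta>" and x: "x \<in> E \<delta>"
    and lip: "1-lipschitz_on (\<Union>\<beta>\<in>{..<\<delta>}. E \<beta>) (descend \<alpha>)"
    and t: "\<And>n. rank (t n) < \<delta>" "t \<longlonglongrightarrow> x"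
  shows "(\<lambda>n. descend \<alpha> (t n)) \<longlonglongrightarrow> descend \<alpha> x"
proof -
  obtain s where s: "\<And>n. rank (s n) < \<delta>" "s \<longlonglongrightarrow> x" "(\<lambda>n. descend \<alpha> (s n)) \<longlonglongrightarrow> descend \<alpha> x"
  proof (cases "rank x < \<delta>")
    case True
    then show ?thesis using that[of "\<lambda>_. x"] by simp
  next
    case False
    then have r: "rank x = \<delta>" using x rank_le_iff by (meson antisym_conv2)
    have low: "rank (lower_seq x n) < \<delta>" "lower_seq x \<longlonglongrightarrow> x" for n
      using lower_seq_limit[of x] \<delta> r by auto
    have "Cauchy (\<lambda>n. descend \<alpha> (lower_seq x n))"
      by (rule uniformly_continuous_on_Cauchy[OF lipschitz_on_uniformly_continuous[OF lip]])
        (use low in \<open>auto simp only: UN_below_iff intro: LIMSEQ_imp_Cauchy\<close>)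
    then have "(\<lambda>n. descend \<alpha> (lower_seq x n)) \<longlonglongrightarrow> descend \<alpha> x"
      using descend_lim[of \<alpha> x] r \<delta> by (simp add: Cauchy_convergent_iff convergent_LIMSEQ_iff)
    then show ?thesis using that[of "lower_seq x"] low by blast
  qed
  have "(\<lambda>n. descend \<alpha> (t n) - descend \<alpha> (s n)) \<longlonglongrightarrow> 0"
  proof (rule Lim_null_comparison)
    have "norm (descend \<alpha> (t n) - descend \<alpha> (s n)) \<le> norm (t n - s n)" for n
      using lipschitz_onD[OF lip, of "t n" "s n"] s t by (simp only: UN_below_iff dist_norm) simp
    then show "\<forall>\<^sub>F n in sequentially. norm (descend \<alpha> (t n) - descend \<alpha> (s n)) \<le> norm (t n - s n)"
      by simp
    show "(\<lambda>n. norm (t n - s n)) \<longlonglongrightarrow> 0"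
      using tendsto_norm[OF tendsto_diff[OF t(2) s(2)]] by simp
  qed
  from tendsto_add[OF this s(3)] show ?thesis by simp
qed

lemma descend_on_skeleton:
  "linear_contraction_on (E \<beta>) (descend \<alpha>) \<and> descend \<alpha> ` E \<beta> \<subseteq> E \<alpha>"
proof (induction \<beta> rule: less_induct)
  case (less \<beta>)
  show ?case
  proof (cases "\<beta> \<le> \<alpha>")
    case True
    then have sub: "E \<beta> \<subseteq> E \<alpha>" using mono_E by (simp add: monoD)
    then have "descend \<alpha> x = x" if "x \<in> E \<beta>" for x using that descend_id by blast
    then show ?thesis
      using sub subspace_E[of \<beta>] unfolding linear_contraction_on_def subspace_def by auto
  next
    case False
    then have "\<alpha> < \<beta>" by simp
    then show ?thesis
    proof (cases rule: omega1_successor_or_limit)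
      case (1 \<gamma>)
      have "linear_contraction_on (E \<gamma>) (descend \<alpha>)" "descend \<alpha> ` E \<gamma> \<subseteq> E \<alpha>"
        using less.IH[of \<gamma>] 1 less_succ_omega1 by auto
      moreover have eq: "descend \<alpha> x = descend \<alpha> (R \<gamma> x)" if "x \<in> E \<beta>" for x
        using that 1 descend_succ by blast
      moreover have "R \<gamma> x \<in> E \<gamma>" if "x \<in> E \<beta>" for x using that 1 R_in by blast
      moreover have "linear_contraction_on (E \<beta>) (R \<gamma>)" using 1 R_contraction by blast
      moreover have "x + y \<in> E \<beta>" "c *\<^sub>R x \<in> E \<beta>" if "x \<in> E \<beta>" "y \<in> E \<beta>" for x y c
        using that subspace_E[of \<beta>] by (auto simp: subspace_add subspace_scale)
      ultimately show ?thesis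
        unfolding linear_contraction_on_def image_subset_iff
        by (smt (verit, best) image_subset_iff order_trans)
    next
      case 2
      let ?U = "\<Union>\<xi>\<in>{..<\<beta>}. E \<xi>"
      have U: "subspace ?U"
        by (rule subspace_UN_chain[OF subspace_E mono_E]) (use \<open>\<alpha> < \<beta>\<close> in auto)
      have lc: "linear_contraction_on ?U (descend \<alpha>)"
        by (rule linear_contraction_on_UN_chain[OF mono_E]) (use less.IH in auto)
      have E: "E \<beta> = closure ?U" using E_limit[OF 2] .
      have cont: "(\<lambda>n. descend \<alpha> (t n)) \<longlonglongrightarrow> descend \<alpha> x"
        if "x \<in> closure ?U" "\<And>n. t n \<in> ?U" "t \<longlonglongrightarrow> x" for x t
        using descend_tendsto_at_limit[OF 2 \<open>\<alpha> < \<beta>\<close> _ linear_contraction_on_lipschitz[OF lc U]]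
          that unfolding UN_below_iff E by blast
      have "linear_contraction_on (closure ?U) (descend \<alpha>)"
        by (rule linear_contraction_on_closure[OF lc U cont])
      moreover have "descend \<alpha> x \<in> E \<alpha>" if x: "x \<in> closure ?U" for x
      proof -
        obtain t where t: "\<And>n. t n \<in> ?U" "t \<longlonglongrightarrow> x" using x closure_sequential by metis
        have "descend \<alpha> (t n) \<in> E \<alpha>" for n using t(1)[of n] less.IH by blast
        then show ?thesis
          using closed_sequentially[OF closed_E _ cont[OF x t]] by blast
      qed
      ultimately show ?thesis unfolding E by blast
    qed
  qed
qed

lemma descend_in: "descend \<alpha> x \<in> E \<alpha>"
  using descend_on_skeleton in_E_rank by blast

lemma range_descend: "range (descend \<alpha>) = E \<alpha>"
  using descend_in descend_id by (metis image_subset_iff subset_antisym subsetI rangeI)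

lemma linear_contraction_descend: "linear_contraction_on UNIV (descend \<alpha>)"
  using linear_contraction_on_UN_chain[OF mono_E, of UNIV] descend_on_skeleton UN_E by metis

lemma bounded_linear_descend: "bounded_linear (descend \<alpha>)"
  using linear_contraction_descend[of \<alpha>] unfolding linear_contraction_on_def
  by (intro bounded_linear_intro[where K=1]) auto

lemma descend_tendsto: "t \<longlonglongrightarrow> x \<Longrightarrow> (\<lambda>n. descend \<alpha> (t n)) \<longlonglongrightarrow> descend \<alpha> x"
  using bounded_linear.tendsto[OF bounded_linear_descend] .

lemma descend_descend:
  assumes "\<alpha> \<le> \<beta>"
  shows "descend \<alpha> (descend \<beta> x) = descend \<alpha> x"
proof (induction "rank x" arbitrary: x rule: less_induct)
  case less
  show ?case
  proof (cases "rank x \<le> \<beta>")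
    case True
    then show ?thesis by (simp add: rank_le_iff descend_id)
  next
    case False
    then have "\<beta> < rank x" by simp
    then show ?thesis
    proof (cases rule: omega1_successor_or_limit)
      case (1 \<gamma>)
      then have x: "x \<in> E (succ_omega1 \<gamma>)" using in_E_rank by metis
      have "rank (R \<gamma> x) < rank x"
        using 1 R_in[OF x] by (metis rank_le_iff less_succ_omega1_iff)
      then show ?thesis
        using less[of "R \<gamma> x"] descend_succ[OF _ x] 1 assms by (metis order_trans)
    next
      case 2
      note low = lower_seq_limit[OF 2]
      have "(\<lambda>n. descend \<alpha> (descend \<beta> (lower_seq x n))) \<longlonglongrightarrow> descend \<alpha> (descend \<beta> x)"
        by (intro descend_tendsto low)
      moreover have "(\<lambda>n. descend \<alpha> (descend \<beta> (lower_seq x n))) = (\<lambda>n. descend \<alpha> (lower_seq x n))"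
        using less low by blast
      ultimately show ?thesis using descend_tendsto[OF low(2)] by (metis LIMSEQ_unique)
    qed
  qed
qed

text \<open>
  Replacing \<open>E \<alpha>\<close> by \<open>E \<alpha>\<^sub>0\<close> for all \<open>\<alpha> < \<alpha>\<^sub>0\<close> removes the trivial subspaces, on which a
  projection would have norm 0. The resolution is then constant up to \<open>\<alpha>\<^sub>0\<close>, and beyond
  \<open>\<alpha>\<^sub>0\<close> the early terms of the union at a limit ordinal are absorbed by the later ones.
\<close>

lemma projectional_resolution_descend:
  assumes v: "v \<in> E \<alpha>\<^sub>0" "v \<noteq> 0"
  shows "projectional_resolution (\<lambda>\<alpha>. descend (max \<alpha>\<^sub>0 \<alpha>))"
  unfolding projectional_resolution_def range_descend
proof (intro conjI allI impI)
  fix \<alpha>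
  show "bounded_linear (descend (max \<alpha>\<^sub>0 \<alpha>))" by (rule bounded_linear_descend)
  show "separable_space (top_of_set (E (max \<alpha>\<^sub>0 \<alpha>)))" by (rule separable_E)
  have "v \<in> E (max \<alpha>\<^sub>0 \<alpha>)" using v mono_E by (meson max.cobounded1 monoD subsetD)
  then show "onorm (descend (max \<alpha>\<^sub>0 \<alpha>)) = 1"
    using linear_contraction_descend v(2) unfolding linear_contraction_on_def
    by (intro onorm_contractive_projection[OF bounded_linear_descend _ descend_id]) auto
next
  fix \<alpha> \<beta> :: omega1 assume "\<alpha> \<le> \<beta>"
  then have le: "max \<alpha>\<^sub>0 \<alpha> \<le> max \<alpha>\<^sub>0 \<beta>" by (simp add: max.coboundedI2)
  then show "descend (max \<alpha>\<^sub>0 \<alpha>) = descend (max \<alpha>\<^sub>0 \<alpha>) \<circ> descend (max \<alpha>\<^sub>0 \<beta>)"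
    by (simp add: fun_eq_iff descend_descend)
  have "descend (max \<alpha>\<^sub>0 \<alpha>) x \<in> E (max \<alpha>\<^sub>0 \<beta>)" for x
    using descend_in mono_E le by (meson monoD subsetD)
  then show "descend (max \<alpha>\<^sub>0 \<alpha>) = descend (max \<alpha>\<^sub>0 \<beta>) \<circ> descend (max \<alpha>\<^sub>0 \<alpha>)"
    by (simp add: fun_eq_iff descend_id)
next
  have "x \<in> E (max \<alpha>\<^sub>0 (rank x))" for x
    by (simp flip: rank_le_iff)
  then show "(\<Union>\<alpha>. E (max \<alpha>\<^sub>0 \<alpha>)) = UNIV" by blast
next
  fix \<delta> assume \<delta>: "limit_omega1 \<delta>"
  show "E (max \<alpha>\<^sub>0 \<delta>) = closure (\<Union>\<xi>\<in>{..<\<delta>}. E (max \<alpha>\<^sub>0 \<xi>))"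
  proof (cases "\<delta> \<le> \<alpha>\<^sub>0")
    case True
    then have "max \<alpha>\<^sub>0 \<xi> = \<alpha>\<^sub>0" if "\<xi> < \<delta>" for \<xi> using that by (simp add: max.absorb1)
    moreover have "{..<\<delta>} \<noteq> {}" using \<delta> unfolding limit_omega1_def by auto
    ultimately have "(\<Union>\<xi>\<in>{..<\<delta>}. E (max \<alpha>\<^sub>0 \<xi>)) = E \<alpha>\<^sub>0" by auto
    then show ?thesis using True closed_E by (simp add: max_def)
  next
    case False
    have "(\<Union>\<xi>\<in>{..<\<delta>}. E (max \<alpha>\<^sub>0 \<xi>)) = (\<Union>\<xi>\<in>{..<\<delta>}. E \<xi>)"
    proof
      show "(\<Union>\<xi>\<in>{..<\<delta>}. E (max \<alpha>\<^sub>0 \<xi>)) \<subseteq> (\<Union>\<xi>\<in>{..<\<delta>}. E \<xi>)"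
        using False by force
      show "(\<Union>\<xi>\<in>{..<\<delta>}. E \<xi>) \<subseteq> (\<Union>\<xi>\<in>{..<\<delta>}. E (max \<alpha>\<^sub>0 \<xi>))"
        by (intro UN_mono order_refl monoD[OF mono_E] max.cobounded2)
    qed
    then show ?thesis using False E_limit[OF \<delta>] by (simp add: max.absorb2)
  qed
qed

end

section \<open>From skeletons to projectional resolutions\<close>

theorem corollary6p2:
  fixes E :: "omega1 \<Rightarrow> 'a::banach set"
  assumes "density_aleph1 TYPE('a)"
    and "skeleton E"
    and "\<forall>\<alpha>. one_complemented (E \<alpha>) (E (succ_omega1 \<alpha>))"
  shows "one_Plichko TYPE('a)"
proof -
  have sub: "E \<gamma> \<subseteq> E (succ_omega1 \<gamma>)" for \<gamma>
    using skeleton_mono[OF assms(2)] less_succ_omega1 by (metis less_imp_le monoD)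
  have "\<exists>P. linear_contraction_on (E (succ_omega1 \<gamma>)) P \<and>
      (\<forall>x\<in>E (succ_omega1 \<gamma>). P x \<in> E \<gamma>) \<and> (\<forall>x\<in>E \<gamma>. P x = x)" for \<gamma>
    using one_complemented_retraction[OF _ sub] assms(3) by metis
  then obtain R where "\<And>\<gamma>. linear_contraction_on (E (succ_omega1 \<gamma>)) (R \<gamma>) \<and>
      (\<forall>x\<in>E (succ_omega1 \<gamma>). R \<gamma> x \<in> E \<gamma>) \<and> (\<forall>x\<in>E \<gamma>. R \<gamma> x = x)"
    by metis
  then interpret complemented_skeleton E R
    by unfold_locales (use assms(2) in auto)
  obtain v :: 'a where "v \<noteq> 0" using density_aleph1_imp_nonzero[OF assms(1)] by blast
  then have "projectional_resolution (\<lambda>\<alpha>. descend (max (rank v) \<alpha>))"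
    using projectional_resolution_descend in_E_rank by blast
  then show ?thesis using assms(1) unfolding one_Plichko_def by blast
qed

end
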